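(* Let $(E,d)$ be an SR metric space. Let $(x_n)_{n\in\mathbb N}\subset E$ be a bounded sequence and let $x\in E$ be such that $$\forall y\in E:\quad d(x_n,x)\le d(x_n,y)+o(1)\qquad(n\to\infty).$$ Then, for each $z\in E$ with $z\ne x$, there exist positive constants $n_0$ and $c$ depending on $z$ such that $$d(x_n,x)\le d(x_n,z)-c\quad\text{for all } n\ge n_0,$$ and so $(x_n)_{n\in\mathbb N}$ polarly converges to $x$.
   Context: For a subset $X$ of a metric space $(E,d)$, its Chebyshev radius is $\mathrm{rad}(X)=\inf_{x\in E}\sup_{y\in X}d(x,y)$. $B_\rho(x)$ denotes the ball of radius $\rho$ centered at $x$. A metric space $(E,d)$ is an SR ("Staples rotund") metric space if there exists a function $\delta:(0,\infty)^2\to(0,\infty)$ such that for all $r,\overline d>0$, setting $\delta=\delta(r,\overline d)$, for all $x,y\in E$ with $d(x,y)\ge\overline d$ one has $$\mathrm{rad}\big(B_{r+\delta}(x)\cap B_{r+\delta}(y)\big)\le r-\delta .$$ A sequence $(x_n)_{n\in\mathbb N}$ in $E$ polarly converges to $x\in E$ if for every $y\in E$ with $y\neq x$ there exists $M(y)\in\mathbb N$ such that $d(x_n,x)<d(x_n,y)$ for all $n\ge M(y)$. $o(1)$ denotes a sequence of real numbers (possibly depending on $y$) converging to $0$. *)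

theory Defs
  imports "HOL-Analysis.Analysis"
begin

context Metric_space
begin

text \<open>
  The radius is taken in \<^typ>\<open>ereal\<close>, so that it is \<open>\<infinity>\<close> for unbounded sets
  and, with nonempty \<^term>\<open>M\<close>, \<open>- \<infinity>\<close> for the empty set.
\<close>

definition chebyshev_radius :: "'a set \<Rightarrow> ereal" where
  "chebyshev_radius X = (INF x\<in>M. SUP y\<in>X. ereal (d x y))"

definition polarly_converges :: "(nat \<Rightarrow> 'a) \<Rightarrow> 'a \<Rightarrow> bool" where
  "polarly_converges u x \<longleftrightarrow>
     x \<in> M \<and> (\<forall>y\<in>M. y \<noteq> x \<longrightarrow> (\<exists>N. \<forall>n\<ge>N. d (u n) x < d (u n) y))"

end

text \<open>
  Staples rotundity. If a value of \<open>\<delta>\<close> is admissible then so is every smaller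
  positive one; hence the notion does not depend on whether balls are open (as here)
  or closed, nor on whether the empty set has radius \<open>- \<infinity>\<close> (as here) or \<open>0\<close>.
\<close>

locale SR_metric_space = Metric_space +
  assumes staples_rotund:
    "\<exists>\<delta> :: real \<Rightarrow> real \<Rightarrow> real. \<forall>r>0. \<forall>D>0.
       \<delta> r D > 0 \<and>
       (\<forall>x\<in>M. \<forall>y\<in>M. d x y \<ge> D \<longrightarrow>
          chebyshev_radius (mball x (r + \<delta> r D) \<inter> mball y (r + \<delta> r D))
            \<le> ereal (r - \<delta> r D))"

end

theory Submission
  imports Defs
begin

text \<open>
  If the gap \<open>d (u n) z - d (u n) x\<close> is not eventually bounded away from \<open>0\<close>, then along a
  subsequence \<open>d (u n) x\<close> converges to some \<open>r\<close> and \<open>limsup d (u n) z \<le> r\<close>; as \<open>z \<noteq> x\<close>, we have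
  \<open>r > 0\<close>. The tail of the subsequence lies in the intersection of the balls of radius \<open>r + \<delta>\<close>
  about \<open>x\<close> and \<open>z\<close>, so by rotundity it is within \<open>r - \<delta>/2\<close> of a single point \<open>y\<close>, which
  contradicts the asymptotic minimality of \<open>x\<close> against \<open>y\<close>.
\<close>

lemma (in Metric_space) chebyshev_radius_lessD:
  assumes "chebyshev_radius X < ereal t"
  obtains y where "y \<in> M" "\<And>w. w \<in> X \<Longrightarrow> d y w < t"
proof -
  obtain y where y: "y \<in> M" "(SUP w\<in>X. ereal (d y w)) < ereal t"
    using assms by (auto simp: chebyshev_radius_def INF_less_iff)
  have "d y w < t" if "w \<in> X" for w
    using SUP_upper[OF that, of "\<lambda>w. ereal (d y w)"] y(2)
    by (metis order.strict_trans1 less_ereal.simps(1))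
  with y(1) show ?thesis using that by blast
qed

lemma (in Metric_space) mbounded_imp_bounded_dist:
  assumes "mbounded (range u)" "x \<in> M"
  shows "bounded (range (\<lambda>n. d (u n) x))"
proof -
  have "mbounded (insert x (range u))"
    using assms by (simp add: mbounded_insert)
  then obtain B where "\<And>n. d (u n) x \<le> B"
    by (auto simp: mbounded_alt)
  then show ?thesis
    by (auto simp: bounded_iff)
qed

text \<open>This isolates the contradiction for a sequence along which \<open>d (u n) x\<close>
  already converges. For \<open>z\<close> only an upper bound up to the null error \<open>g\<close>
  is assumed, which is all that membership in a ball about \<open>z\<close> takes.\<close>

lemma (in SR_metric_space) no_two_asymptotic_centers:
  assumes uM: "range u \<subseteq> M" and xM: "x \<in> M" and zM: "z \<in> M" and "z \<noteq> x"
    and lim: "(\<lambda>n. d (u n) x) \<longlonglongrightarrow> r"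
    and gap: "\<And>n. d (u n) z \<le> d (u n) x + g n" "g \<longlonglongrightarrow> 0"
    and min: "\<And>y. y \<in> M \<Longrightarrow> \<exists>e. e \<longlonglongrightarrow> 0 \<and> (\<forall>n. d (u n) x \<le> d (u n) y + e n)"
  shows False
proof -
  have u: "u n \<in> M" for n
    using uM by auto
  have D: "d x z > 0"
    using xM zM \<open>z \<noteq> x\<close> by simp
  have lim_g: "(\<lambda>n. d (u n) x + g n) \<longlonglongrightarrow> r"
    using tendsto_add[OF lim gap(2)] by simp
  \<comment> \<open>Rotundity applies to positive radii only. Going from \<open>x\<close> to
    \<open>z\<close> through \<open>u n\<close> gives \<open>d x z \<le> 2 * r\<close> in the limit,
    hence \<open>r > 0\<close>.\<close>
  have "d x z \<le> d (u n) x + (d (u n) x + g n)" for n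
    using triangle[OF xM u[of n] zM] gap(1)[of n] by (simp add: commute)
  then have "d x z \<le> r + r"
    using LIMSEQ_le_const[OF tendsto_add[OF lim lim_g]] by blast
  with D have "r > 0"
    by simp
  \<comment> \<open>The separation parameter is \<open>d x z\<close> itself.\<close>
  obtain \<delta> where \<delta>: "\<delta> > 0"
    "chebyshev_radius (mball x (r + \<delta>) \<inter> mball z (r + \<delta>)) \<le> ereal (r - \<delta>)"
    using staples_rotund \<open>r > 0\<close> D xM zM by (metis order_refl)
  \<comment> \<open>The infimum over centres need not be attained; giving up half of
    \<open>\<delta>\<close> makes the bound strict, so that an actual centre \<open>y\<close>
    exists.\<close>
  then have "chebyshev_radius (mball x (r + \<delta>) \<inter> mball z (r + \<delta>)) < ereal (r - \<delta>/2)"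
    by (smt (verit) field_sum_of_halves le_ereal_less less_ereal.simps(1) order.strict_trans1)
  then obtain y where y: "y \<in> M"
    "\<And>w. w \<in> mball x (r + \<delta>) \<inter> mball z (r + \<delta>) \<Longrightarrow> d y w < r - \<delta>/2"
    by (rule chebyshev_radius_lessD) blast
  obtain e where e: "e \<longlonglongrightarrow> 0" "\<And>n. d (u n) x \<le> d (u n) y + e n"
    using min[OF y(1)] by blast
  \<comment> \<open>The second bound controls \<open>d (u n) z\<close> through its majorant from
    \<open>gap\<close>.\<close>
  have "\<forall>\<^sub>F n in sequentially. d (u n) x < r + \<delta>" "\<forall>\<^sub>F n in sequentially. d (u n) x + g n < r + \<delta>"
    using order_tendstoD(2)[OF lim] order_tendstoD(2)[OF lim_g] \<delta>(1) by simp_all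
  then have "\<forall>\<^sub>F n in sequentially. d (u n) x \<le> r - \<delta>/2 + e n"
  proof eventually_elim
    case (elim n)
    then have "u n \<in> mball x (r + \<delta>) \<inter> mball z (r + \<delta>)"
      using u xM zM gap(1)[of n] by (simp add: commute)
    from y(2)[OF this] e(2)[of n] show ?case
      by (simp add: commute)
  qed
  then have "r \<le> r - \<delta>/2 + 0"
    using tendsto_le[OF _ tendsto_add[OF tendsto_const e(1)] lim] by simp
  with \<delta>(1) show False
    by simp
qed

lemma (in SR_metric_space) asymptotic_center_gap:
  assumes uM: "range u \<subseteq> M" and "mbounded (range u)" and xM: "x \<in> M"
    and min: "\<And>y. y \<in> M \<Longrightarrow> \<exists>e. e \<longlonglongrightarrow> 0 \<and> (\<forall>n. d (u n) x \<le> d (u n) y + e n)"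
    and zM: "z \<in> M" and "z \<noteq> x"
  shows "\<exists>n0>0. \<exists>c>0. \<forall>n\<ge>n0. d (u n) x \<le> d (u n) z - c"
proof (rule ccontr)
  assume contra: "\<not> ?thesis"
  \<comment> \<open>The negated goal is used with \<open>n0 = Suc k\<close>, which is positive as
    required, and \<open>c = 1/(k+1)\<close>.\<close>
  have "\<exists>n\<ge>Suc k. d (u n) z < d (u n) x + inverse (real (Suc k))" for k
  proof (rule ccontr)
    assume "\<not> ?thesis"
    then have "\<forall>n\<ge>Suc k. d (u n) x \<le> d (u n) z - inverse (real (Suc k))"
      by force
    then show False
      using contra by (metis inverse_positive_iff_positive of_nat_0_less_iff zero_less_Suc)
  qed
  then obtain m where m: "\<And>k. m k \<ge> Suc k"
    "\<And>k. d (u (m k)) z < d (u (m k)) x + inverse (real (Suc k))"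
    by metis
  have "bounded (range (\<lambda>k. d (u (m k)) x))"
    by (rule bounded_subset[OF mbounded_imp_bounded_dist[OF assms(2) xM]]) auto
  then obtain r s where s: "strict_mono s" and r: "((\<lambda>k. d (u (m k)) x) \<circ> s) \<longlonglongrightarrow> r"
    using bounded_imp_convergent_subsequence by blast
  \<comment> \<open>The choice \<open>m\<close> need not be monotone, so \<open>m \<circ> s\<close>
    may fail to be a subsequence in the strict sense. Divergence to infinity is enough: it keeps the
    error sequences from \<open>min\<close> null after composition.\<close>
  have ms: "filterlim (\<lambda>k. m (s k)) at_top sequentially"
  proof (rule filterlim_at_top_mono[OF filterlim_ident always_eventually], rule allI)
    show "k \<le> m (s k)" for k
      using m(1)[of "s k"] seq_suble[OF s, of k] by linarith
  qed
  show False
  proof (rule no_two_asymptotic_centers[OF _ xM zM \<open>z \<noteq> x\<close>])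
    show "range (\<lambda>k. u (m (s k))) \<subseteq> M"
      using uM by auto
    show "(\<lambda>k. d (u (m (s k))) x) \<longlonglongrightarrow> r"
      using r by (simp add: o_def)
    show "d (u (m (s k))) z \<le> d (u (m (s k))) x + inverse (real (Suc (s k)))" for k
      using m(2)[of "s k"] by simp
    show "(\<lambda>k. inverse (real (Suc (s k)))) \<longlonglongrightarrow> 0"
      using LIMSEQ_subseq_LIMSEQ[OF LIMSEQ_inverse_real_of_nat s] by (simp add: o_def)
    show "\<exists>e. e \<longlonglongrightarrow> 0 \<and> (\<forall>k. d (u (m (s k))) x \<le> d (u (m (s k))) y + e k)" if "y \<in> M" for y
      using min[OF that] filterlim_compose[OF _ ms] by blast
  qed
qed

theorem lemma3p5:
  fixes E :: "'a set" and d :: "'a \<Rightarrow> 'a \<Rightarrow> real"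
    and u :: "nat \<Rightarrow> 'a" and x :: 'a
  assumes "SR_metric_space E d"
    and "range u \<subseteq> E"
    and "Metric_space.mbounded E d (range u)"
    and "x \<in> E"
    and "\<forall>y\<in>E. \<exists>e :: nat \<Rightarrow> real. e \<longlonglongrightarrow> 0 \<and> (\<forall>n. d (u n) x \<le> d (u n) y + e n)"
  shows "(\<forall>z\<in>E. z \<noteq> x \<longrightarrow>
            (\<exists>n0 :: nat. \<exists>c :: real. n0 > 0 \<and> c > 0 \<and>
               (\<forall>n\<ge>n0. d (u n) x \<le> d (u n) z - c)))
         \<and> Metric_space.polarly_converges E d u x"
proof -
  interpret SR_metric_space E d
    by fact
  have gap: "\<exists>n0>0. \<exists>c>0. \<forall>n\<ge>n0. d (u n) x \<le> d (u n) z - c" if "z \<in> E" "z \<noteq> x" for z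
    using asymptotic_center_gap[OF assms(2-4) _ that] assms(5) by blast
  moreover have "polarly_converges u x"
    unfolding polarly_converges_def using assms(4) gap by (smt (verit))
  ultimately show ?thesis
    by blast
qed

end
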